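(* Let $n$ be a positive integer. Then every integer in the set $\{0,1,\ldots,n\}\setminus\{\lfloor n/2\rfloor\}$ is an eigenvalue of the adjacency matrix of the burnt pancake graph $\mathbb{BP}_n$.
   Context: For a positive integer $n$, let $\pm[n]=\{-n,\ldots,-1,1,\ldots,n\}$ and let $B_n$ be the hyperoctahedral group of all bijections $\sigma:\pm[n]\to\pm[n]$ satisfying $\sigma(-i)=-\sigma(i)$ for $1\le i\le n$ (so $|B_n|=2^n n!$). An element $\sigma\in B_n$ is written in one-line notation $\sigma=\sigma_1\sigma_2\cdots\sigma_n$ with $\sigma_i=\sigma(i)$; a bar denotes a negative sign, $\overline{a}=-a$. For $1\le i\le n$ the $i$-th signed prefix reversal $r_i:B_n\to B_n$ is defined by $$r_i(\sigma_1\cdots\sigma_n)=\overline{\sigma_i}\,\overline{\sigma_{i-1}}\cdots\overline{\sigma_1}\,\sigma_{i+1}\cdots\sigma_n .$$ The burnt pancake graph $\mathbb{BP}_n$ is the (undirected, simple, $n$-regular) graph with vertex set $B_n$ in which $\sigma$ and $r_i(\sigma)$ are adjacent for every $\sigma\in B_n$ and $1\le i\le n$. *)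

theory Defs
  imports "HOL-Combinatorics.Permutations" "Jordan_Normal_Form.Char_Poly"
begin

definition pm_interval :: "nat \<Rightarrow> int set" where
  "pm_interval n = {- int n..-1} \<union> {1..int n}"

text \<open>Signed permutations are total functions on the integers which, by
  \<^const>\<open>permutes\<close>, are the identity outside \<^const>\<open>pm_interval\<close>.\<close>

definition hyperoctahedral :: "nat \<Rightarrow> (int \<Rightarrow> int) set" where
  "hyperoctahedral n =
     {\<sigma>. \<sigma> permutes pm_interval n \<and> (\<forall>i\<in>{1..int n}. \<sigma> (- i) = - \<sigma> i)}"

text \<open>The second branch is forced by oddness: the value at \<open>j < 0\<close> is minus the value at \<open>- j\<close>.\<close>

definition prefix_reversal :: "nat \<Rightarrow> (int \<Rightarrow> int) \<Rightarrow> int \<Rightarrow> int" where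
  "prefix_reversal i \<sigma> = (\<lambda>j.
     if j \<in> {1..int i} then - \<sigma> (int i + 1 - j)
     else if j \<in> {- int i..-1} then \<sigma> (int i + 1 + j)
     else \<sigma> j)"

definition burnt_pancake_edges :: "nat \<Rightarrow> (int \<Rightarrow> int) set set" where
  "burnt_pancake_edges n =
     {{\<sigma>, prefix_reversal i \<sigma>} | \<sigma> i. \<sigma> \<in> hyperoctahedral n \<and> i \<in> {1..n}}"

text \<open>Rows and columns follow an enumeration \<open>vs\<close> of the vertex set.\<close>

definition adjacency_matrix :: "'a list \<Rightarrow> 'a set set \<Rightarrow> real mat" where
  "adjacency_matrix vs E =
     mat (length vs) (length vs) (\<lambda>(i, j). if {vs ! i, vs ! j} \<in> E then 1 else 0)"

lemma finite_hyperoctahedral: "finite (hyperoctahedral n)"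
proof -
  have "finite {\<sigma>. \<sigma> permutes pm_interval n}"
    by (rule finite_permutations) (simp add: pm_interval_def)
  then show ?thesis
    by (rule rev_finite_subset) (auto simp: hyperoctahedral_def)
qed

lemma hyperoctahedral_odd:
  assumes "\<sigma> \<in> hyperoctahedral n"
  shows "\<sigma> (- j) = - \<sigma> j"
proof -
  have p: "\<sigma> permutes pm_interval n" and o: "\<And>i. i \<in> {1..int n} \<Longrightarrow> \<sigma> (- i) = - \<sigma> i"
    using assms by (auto simp: hyperoctahedral_def)
  consider "j \<in> {1..int n}" | "- j \<in> {1..int n}" | "j \<notin> pm_interval n" "- j \<notin> pm_interval n"
    unfolding pm_interval_def Un_iff atLeastAtMost_iff by linarith
  then show ?thesis
    using o[of j] o[of "- j"] permutes_not_in[OF p] by cases auto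
qed

lemma prefix_reversal_involution:
  assumes "\<sigma> \<in> hyperoctahedral n"
  shows "prefix_reversal i (prefix_reversal i \<sigma>) = \<sigma>"
proof
  fix j
  show "prefix_reversal i (prefix_reversal i \<sigma>) j = \<sigma> j"
    using hyperoctahedral_odd[OF assms, of j]
    by (simp add: prefix_reversal_def)
qed

lemma prefix_reversal_closed:
  assumes s: "\<sigma> \<in> hyperoctahedral n" and i: "i \<in> {1..n}"
  shows "prefix_reversal i \<sigma> \<in> hyperoctahedral n"
proof -
  let ?r = "prefix_reversal i \<sigma>"
  have p: "\<sigma> permutes pm_interval n" using s by (simp add: hyperoctahedral_def)
  define \<rho> where "\<rho> = prefix_reversal i (\<lambda>j. j)"
  have \<rho>: "\<rho> j = (if 1 \<le> j \<and> j \<le> int i then j - int i - 1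
      else if - int i \<le> j \<and> j \<le> -1 then int i + 1 + j else j)" for j
    unfolding \<rho>_def prefix_reversal_def atLeastAtMost_iff by (simp only: minus_diff_eq diff_diff_eq)
  have inv: "\<rho> (\<rho> j) = j" for j
    unfolding \<rho> by (smt (verit))
  have closed: "\<rho> j \<in> pm_interval n" if "j \<in> pm_interval n" for j
  proof -
    have "int i \<le> int n" using i by simp
    then show ?thesis
      using that unfolding \<rho> pm_interval_def Un_iff atLeastAtMost_iff by (smt (verit))
  qed
  have "bij_betw \<rho> (pm_interval n) (pm_interval n)"
    by (rule bij_betw_byWitness[where f' = \<rho>]) (use inv closed in blast)+
  moreover have "\<rho> j = j" if "j \<notin> pm_interval n" for j
  proof -
    have "int i \<le> int n" using i by simp
    then show ?thesis
      using that unfolding \<rho> pm_interval_def Un_iff atLeastAtMost_iff by (smt (verit))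
  qed
  ultimately have "\<rho> permutes pm_interval n" by (rule bij_imp_permutes)
  from permutes_compose[OF this p] have "\<sigma> \<circ> \<rho> permutes pm_interval n" .
  moreover have comp: "?r = \<sigma> \<circ> \<rho>"
  proof
    fix j
    have "\<sigma> (j - int i - 1) = - \<sigma> (int i + 1 - j)"
      using hyperoctahedral_odd[OF s, of "int i + 1 - j"] by (simp only: minus_diff_eq diff_diff_eq)
    then show "?r j = (\<sigma> \<circ> \<rho>) j"
      unfolding comp_def \<rho> prefix_reversal_def atLeastAtMost_iff by (simp only: if_distrib[of \<sigma>])
  qed
  moreover have "?r (- j) = - ?r j" for j
  proof -
    have "\<rho> (- j) = - \<rho> j" unfolding \<rho> by (smt (verit))
    then show ?thesis unfolding comp by (simp only: comp_def hyperoctahedral_odd[OF s])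
  qed
  ultimately show ?thesis by (simp add: hyperoctahedral_def)
qed

lemma prefix_reversal_neq:
  assumes s: "\<sigma> \<in> hyperoctahedral n" and i: "i \<in> {1..n}"
  shows "prefix_reversal i \<sigma> \<noteq> \<sigma>"
proof
  assume eq: "prefix_reversal i \<sigma> = \<sigma>"
  have "\<sigma> 1 = \<sigma> (- int i)"
    using fun_cong[OF eq, of 1] i hyperoctahedral_odd[OF s, of "int i"]
    by (simp add: prefix_reversal_def)
  moreover have "inj \<sigma>" using s permutes_inj by (auto simp: hyperoctahedral_def)
  ultimately have "1 = - int i" by (simp only: inj_eq)
  then show False by linarith
qed

end

theory Submission
  imports Defs
begin

text \<open>
  Fix a label \<open>c\<close> and consider functions of \<open>\<sigma>\<close> depending only on the position \<open>p\<close> with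
  \<open>\<bar>\<sigma> p\<bar> = c\<close>. The reversal \<open>r\<^sub>i\<close> fixes \<open>p\<close> if \<open>i < p\<close> and sends it to \<open>i + 1 - p\<close> otherwise, so on
  such functions \<open>g\<close> the adjacency operator acts by
  \<open>g \<mapsto> (\<lambda>p. (p - 1) g p + (g 1 + \<dots> + g (n + 1 - p)))\<close>. This operator has an explicit eigenbasis of
  step functions: for \<open>2 k < n\<close>, the function equal to \<open>1\<close> on \<open>{k + 1..n - k}\<close> and to \<open>- (n - 2 k)\<close> at
  \<open>n + 1 - k\<close> has eigenvalue \<open>n - k\<close>; for \<open>2 k + 2 \<le> n\<close>, the function equal to \<open>1\<close> on
  \<open>{k + 2..n - k}\<close> and to \<open>- (n - 1 - 2 k)\<close> at \<open>k + 1\<close> has eigenvalue \<open>k\<close>. Choosing \<open>c\<close> with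
  \<open>g c \<noteq> 0\<close> makes the lifted function nonzero at the identity permutation.
\<close>

text \<open>Listing the values of \<open>f\<close> along \<open>vs\<close> turns the neighbour-sum
  equation into the matrix equation; distinctness of \<open>vs\<close> lets a sum over indices
  become a sum over vertices.\<close>

lemma eigenvalue_adjacency_matrixI:
  fixes f :: "'a \<Rightarrow> real"
  assumes "distinct vs" and "x \<in> set vs" and "f x \<noteq> 0"
    and eig: "\<And>x. x \<in> set vs \<Longrightarrow> (\<Sum>y | y \<in> set vs \<and> {x, y} \<in> E. f y) = ev * f x"
  shows "eigenvalue (adjacency_matrix vs E) ev"
proof -
  let ?N = "length vs" and ?A = "adjacency_matrix vs E"
  define v where "v = vec ?N (\<lambda>i. f (vs ! i))"
  obtain i0 where i0: "i0 < ?N" "vs ! i0 = x"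
    using assms(2) by (auto simp: in_set_conv_nth)
  have dim: "dim_row ?A = ?N" "dim_col ?A = ?N"
    by (auto simp: adjacency_matrix_def)
  have "v $ i0 \<noteq> 0\<^sub>v ?N $ i0" using i0 assms(3) by (simp add: v_def)
  then have nz: "v \<noteq> 0\<^sub>v ?N" by auto
  have "?A *\<^sub>v v = ev \<cdot>\<^sub>v v"
  proof (rule eq_vecI)
    fix i assume "i < dim_vec (ev \<cdot>\<^sub>v v)"
    then have i: "i < ?N" by (simp add: v_def)
    have "(?A *\<^sub>v v) $ i = (\<Sum>j<?N. if {vs ! i, vs ! j} \<in> E then f (vs ! j) else 0)"
      using i dim by (auto simp: scalar_prod_def v_def adjacency_matrix_def lessThan_atLeast0
          intro!: sum.cong)
    also have "\<dots> = (\<Sum>y\<in>set vs. if {vs ! i, y} \<in> E then f y else 0)"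
      by (rule sum.reindex_bij_betw[OF bij_betw_nth[OF assms(1) refl refl]])
    also have "\<dots> = (\<Sum>y | y \<in> set vs \<and> {vs ! i, y} \<in> E. f y)"
      by (simp add: sum.inter_filter)
    also have "\<dots> = ev * f (vs ! i)" using eig i by simp
    finally show "(?A *\<^sub>v v) $ i = (ev \<cdot>\<^sub>v v) $ i" using i by (simp add: v_def)
  qed (simp add: dim v_def)
  then show ?thesis
    using nz unfolding eigenvalue_def eigenvector_def dim
    by (intro exI[of _ v]) (simp add: v_def)
qed

text \<open>An edge may record \<open>\<sigma>\<close> as the reversed endpoint; each reversal being
  an involution, the other endpoint is still a reversal of \<open>\<sigma>\<close>.\<close>

lemma neighbours_burnt_pancake:
  assumes s: "\<sigma> \<in> hyperoctahedral n"
  shows "{\<tau>. \<tau> \<in> hyperoctahedral n \<and> {\<sigma>, \<tau>} \<in> burnt_pancake_edges n}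
    = (\<lambda>i. prefix_reversal i \<sigma>) ` {1..n}" (is "?L = ?R")
proof
  show "?L \<subseteq> ?R"
  proof
    fix \<tau> assume "\<tau> \<in> ?L"
    then obtain \<rho> i where i: "i \<in> {1..n}" and "\<rho> \<in> hyperoctahedral n"
      and "{\<sigma>, \<tau>} = {\<rho>, prefix_reversal i \<rho>}"
      by (auto simp: burnt_pancake_edges_def)
    then have "\<tau> = prefix_reversal i \<sigma>"
      using prefix_reversal_involution by (metis doubleton_eq_iff)
    then show "\<tau> \<in> ?R" using i by blast
  qed
  show "?R \<subseteq> ?L"
    using s prefix_reversal_closed[OF s] unfolding burnt_pancake_edges_def by blast
qed

lemma inj_on_prefix_reversal:
  assumes s: "\<sigma> \<in> hyperoctahedral n"
  shows "inj_on (\<lambda>i. prefix_reversal i \<sigma>) {1..n}"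
proof (rule inj_onI)
  fix i j assume ij: "i \<in> {1..n}" "j \<in> {1..n}"
    and eq: "prefix_reversal i \<sigma> = prefix_reversal j \<sigma>"
  have "inj \<sigma>" using s permutes_inj by (auto simp: hyperoctahedral_def)
  \<comment> \<open>The first entry after reversal is \<open>- \<sigma> i\<close>, from which
    \<open>i\<close> can be read off.\<close>
  moreover have "\<sigma> (int i) = \<sigma> (int j)"
    using fun_cong[OF eq, of 1] ij by (simp add: prefix_reversal_def)
  ultimately show "i = j" by (simp add: inj_eq)
qed

definition position :: "nat \<Rightarrow> nat \<Rightarrow> (int \<Rightarrow> int) \<Rightarrow> nat" where
  "position n c \<sigma> = (THE p. p \<in> {1..n} \<and> \<bar>\<sigma> (int p)\<bar> = int c)"

lemma position_eqI:
  assumes s: "\<sigma> \<in> hyperoctahedral n" and p: "p \<in> {1..n}" "\<bar>\<sigma> (int p)\<bar> = int c"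
  shows "position n c \<sigma> = p"
  unfolding position_def
proof (rule the_equality)
  fix q assume q: "q \<in> {1..n} \<and> \<bar>\<sigma> (int q)\<bar> = int c"
  have "inj \<sigma>" using s permutes_inj by (auto simp: hyperoctahedral_def)
  \<comment> \<open>Oddness turns a sign mismatch into the value at \<open>- p\<close>, which
    positivity of \<open>q\<close> then excludes.\<close>
  moreover have "\<sigma> (int q) = \<sigma> (int p) \<or> \<sigma> (int q) = \<sigma> (- int p)"
    using p q hyperoctahedral_odd[OF s, of "int p"] by linarith
  ultimately have "int q = int p \<or> int q = - int p" by (simp add: inj_eq)
  then show "q = p" using p q by auto
qed (use p in simp)

lemma position_exists:
  assumes s: "\<sigma> \<in> hyperoctahedral n" and c: "c \<in> {1..n}"
  obtains p where "p \<in> {1..n}" "\<bar>\<sigma> (int p)\<bar> = int c"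
proof -
  have "\<sigma> permutes pm_interval n" using s by (simp add: hyperoctahedral_def)
  moreover have "int c \<in> pm_interval n" using c by (simp add: pm_interval_def)
  ultimately obtain j where j: "j \<in> pm_interval n" "\<sigma> j = int c"
    using permutes_image by (metis imageE)
  have "\<bar>\<sigma> \<bar>j\<bar>\<bar> = int c"
    using j hyperoctahedral_odd[OF s, of j] by (cases "j \<ge> 0") auto
  then show thesis
    using j by (intro that[of "nat \<bar>j\<bar>"]) (auto simp: pm_interval_def)
qed

lemma position_prefix_reversal:
  assumes s: "\<sigma> \<in> hyperoctahedral n" and p: "p \<in> {1..n}" "\<bar>\<sigma> (int p)\<bar> = int c"
    and i: "i \<in> {1..n}"
  shows "position n c (prefix_reversal i \<sigma>) = (if p \<le> i then i + 1 - p else p)"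
  using p i by (intro position_eqI prefix_reversal_closed s)
    (auto simp: prefix_reversal_def of_nat_diff)

text \<open>The \<open>p - 1\<close> reversals with \<open>i < p\<close> leave \<open>p\<close> in
  place; for \<open>i \<ge> p\<close> the new position \<open>i + 1 - p\<close> takes each value in
  \<open>{1..n + 1 - p}\<close> once.\<close>

lemma sum_over_reversals:
  fixes g :: "nat \<Rightarrow> real"
  assumes p: "p \<in> {1..n}"
  shows "(\<Sum>i=1..n. g (if p \<le> i then i + 1 - p else p))
    = (real p - 1) * g p + (\<Sum>m=1..n + 1 - p. g m)"
proof -
  have split: "{1..n} = {1..<p} \<union> {p..n}" using p by auto
  have "(\<Sum>i=1..n. g (if p \<le> i then i + 1 - p else p))
    = (\<Sum>i=1..<p. g p) + (\<Sum>i=p..n. g (i + 1 - p))"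
    unfolding split by (subst sum.union_disjoint) (auto intro!: arg_cong2[where f = "(+)"] sum.cong)
  also have "(\<Sum>i=p..n. g (i + 1 - p)) = (\<Sum>m=1..n + 1 - p. g m)"
    by (rule sum.reindex_bij_witness[of _ "\<lambda>m. m + p - 1" "\<lambda>i. i + 1 - p"]) (use p in auto)
  finally show ?thesis using p by (simp add: of_nat_diff)
qed

lemma eigenvalue_burnt_pancakeI:
  fixes g :: "nat \<Rightarrow> real"
  assumes vs: "distinct vs" "set vs = hyperoctahedral n"
    and c: "c \<in> {1..n}" "g c \<noteq> 0"
    and eig: "\<And>p. p \<in> {1..n} \<Longrightarrow> (real p - 1) * g p + (\<Sum>m=1..n + 1 - p. g m) = ev * g p"
  shows "eigenvalue (adjacency_matrix vs (burnt_pancake_edges n)) ev"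
proof (rule eigenvalue_adjacency_matrixI[where f = "\<lambda>\<sigma>. g (position n c \<sigma>)" and x = id])
  have id: "id \<in> hyperoctahedral n" by (simp add: hyperoctahedral_def permutes_id)
  then show "id \<in> set vs" by (simp add: vs)
  show "g (position n c id) \<noteq> 0" using position_eqI[OF id c(1), of c] c(2) by simp
next
  fix \<sigma> assume "\<sigma> \<in> set vs"
  then have s: "\<sigma> \<in> hyperoctahedral n" by (simp add: vs)
  obtain p where p: "p \<in> {1..n}" "\<bar>\<sigma> (int p)\<bar> = int c" using position_exists[OF s c(1)] .
  have "(\<Sum>\<tau> | \<tau> \<in> set vs \<and> {\<sigma>, \<tau>} \<in> burnt_pancake_edges n. g (position n c \<tau>))
    = (\<Sum>i=1..n. g (position n c (prefix_reversal i \<sigma>)))"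
    unfolding vs neighbours_burnt_pancake[OF s]
    by (simp only: sum.reindex[OF inj_on_prefix_reversal[OF s]] comp_def)
  also have "\<dots> = (\<Sum>i=1..n. g (if p \<le> i then i + 1 - p else p))"
    by (intro sum.cong refl) (simp only: position_prefix_reversal[OF s p])
  also have "\<dots> = ev * g p" using eig[OF p(1)] sum_over_reversals[OF p(1)] by simp
  finally show "(\<Sum>\<tau> | \<tau> \<in> set vs \<and> {\<sigma>, \<tau>} \<in> burnt_pancake_edges n. g (position n c \<tau>))
    = ev * g (position n c \<sigma>)"
    using position_eqI[OF s p] by simp
qed (rule vs)

lemma eigenvalue_burnt_pancake_upper:
  assumes vs: "distinct vs" "set vs = hyperoctahedral n" and k: "2 * k < n"
  shows "eigenvalue (adjacency_matrix vs (burnt_pancake_edges n)) (real n - real k)"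
proof -
  define g :: "nat \<Rightarrow> real" where "g m =
    (if k < m \<and> m \<le> n - k then 1 else if m = n + 1 - k then - (real n - 2 * real k) else 0)" for m
  \<comment> \<open>The entry at \<open>n + 1 - k\<close> cancels the \<open>n - 2 * k\<close> ones.
    Replacing \<open>p\<close> by \<open>n + 1 - p\<close> preserves \<open>{k + 1..n - k}\<close>,
    where the sum \<open>n + 1 - p - k\<close> and \<open>p - 1\<close> add up to
    \<open>n - k\<close>. For \<open>k = 0\<close> the cancelling entry lies outside
    \<open>{1..n}\<close>, and \<open>g\<close> is constant there.\<close>
  have S: "(\<Sum>m=1..q. g m) = (if k < q \<and> q \<le> n - k then real q - real k else 0)" for q
    using k by (induction q) (auto simp: g_def of_nat_diff not_less_eq less_Suc_eq)
  have "g (k + 1) \<noteq> 0" using k by (simp add: g_def)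
  moreover have "(real p - 1) * g p + (\<Sum>m=1..n + 1 - p. g m) = (real n - real k) * g p"
    if "p \<in> {1..n}" for p
    unfolding S using k that by (auto simp: g_def of_nat_diff)
  ultimately show ?thesis
    using k by (intro eigenvalue_burnt_pancakeI[OF vs, of "k + 1" g]) auto
qed

lemma eigenvalue_burnt_pancake_lower:
  assumes vs: "distinct vs" "set vs = hyperoctahedral n" and k: "2 * k + 2 \<le> n"
  shows "eigenvalue (adjacency_matrix vs (burnt_pancake_edges n)) (real k)"
proof -
  define g :: "nat \<Rightarrow> real" where "g m =
    (if m = k + 1 then - (real n - 1 - 2 * real k) else if k + 1 < m \<and> m \<le> n - k then 1 else 0)" for m
  \<comment> \<open>The sums climb from the negative entry to 0 at \<open>q = n - k\<close>, the
    value needed for \<open>p = k + 1\<close>; for \<open>p\<close> in \<open>{k + 2..n - k}\<close>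
    the sum is \<open>k + 1 - p\<close>, which with \<open>p - 1\<close> gives
    \<open>k\<close>.\<close>
  have S: "(\<Sum>m=1..q. g m) = (if k < q \<and> q \<le> n - k then real q + real k - real n else 0)" for q
    using k by (induction q) (auto simp: g_def of_nat_diff not_less_eq less_Suc_eq)
  have "g (k + 2) \<noteq> 0" using k by (simp add: g_def)
  moreover have "(real p - 1) * g p + (\<Sum>m=1..n + 1 - p. g m) = real k * g p"
    if "p \<in> {1..n}" for p
    unfolding S using k that by (auto simp: g_def of_nat_diff)
  ultimately show ?thesis
    using k by (intro eigenvalue_burnt_pancakeI[OF vs, of "k + 2" g]) auto
qed

theorem theorem5:
  fixes n :: nat and k :: int and vs :: "(int \<Rightarrow> int) list"
  assumes "n > 0"
    and "distinct vs" and "set vs = hyperoctahedral n"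
    and "k \<in> {0..int n} - {\<lfloor>real n / 2\<rfloor>}"
  shows "eigenvalue (adjacency_matrix vs (burnt_pancake_edges n)) (of_int k)"
proof -
  have fl: "\<lfloor>real n / 2\<rfloor> = int (n div 2)" using floor_divide_of_nat_eq[of n 2] by simp
  obtain l where l: "k = int l" using assms(4) nonneg_int_cases by auto
  have "l \<le> n" "l \<noteq> n div 2" using assms(4) unfolding fl l by auto
  \<comment> \<open>The cases are \<open>l\<close> below and above \<open>n div 2\<close>; the
    second uses the upper family with index \<open>n - l\<close>.\<close>
  then consider "2 * l + 2 \<le> n" | "l \<le> n" "2 * (n - l) < n" by linarith
  then show ?thesis
  proof cases
    case 1
    then show ?thesis using eigenvalue_burnt_pancake_lower[OF assms(2,3)] l by simp
  next
    case 2
    then show ?thesis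
      using eigenvalue_burnt_pancake_upper[OF assms(2,3) 2(2)] l by (simp add: of_nat_diff)
  qed
qed

end
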